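(* Let $a,b\in\mathbb{Z}\setminus\{0\}$. The Diophantine equation $a(x^2-y^6)=b(z^6-w^6)$ has infinitely many non-trivial solutions in coprime polynomials $x,y,z,w\in\mathbb{Z}[t]$. Moreover, the set of rational points on the surface $S:\;a(x^2-y^6)=b(z^6-w^6)$ is dense in the set of real points of $S$ in the Euclidean topology.
   Context: A solution is called trivial if both sides of the equation vanish separately for trivial reasons (e.g. $x^2=y^6$ and $z^6=w^6$), representing lines and curves on the surface; such trivial solutions are discarded and only non-trivial solutions are counted. "Coprime polynomials" means $\gcd(x,y,z,w)=1$ in $\mathbb{Z}[t]$. *)

theory Defs
  imports "HOL-Analysis.Analysis" "HOL-Computational_Algebra.Polynomial_Factorial"
begin

text \<open>The equation is stated over an arbitrary commutative ring, so that the same predicate is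
  used over the polynomial ring, over the rationals and over the reals.\<close>

definition solves_eqn :: "int \<Rightarrow> int \<Rightarrow> 'a::comm_ring_1 \<times> 'a \<times> 'a \<times> 'a \<Rightarrow> bool" where
  "solves_eqn a b = (\<lambda>(x, y, z, w).
     of_int a * (x ^ 2 - y ^ 6) = of_int b * (z ^ 6 - w ^ 6))"

definition trivial_sol :: "int \<Rightarrow> int \<Rightarrow> 'a::comm_ring_1 \<times> 'a \<times> 'a \<times> 'a \<Rightarrow> bool" where
  "trivial_sol a b = (\<lambda>(x, y, z, w).
     of_int a * (x ^ 2 - y ^ 6) = 0 \<and> of_int b * (z ^ 6 - w ^ 6) = 0)"

text \<open>The equation is homogeneous of degree 6 for the weights 3, 1, 1, 1 of x, y, z, w and thus
  defines a surface in the weighted projective space P(3,1,1,1). Only points with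
  (y, z, w) nonzero lie on the surface, and such a point is real (rational) iff it has a real
  (rational) coordinate vector, since one of y, z, w can be scaled to 1.
  The real locus is represented by the orbits of nonzero real vectors under the weighted action
  of the nonzero reals, with the quotient of the Euclidean topology.\<close>

type_synonym real4 = "real \<times> real \<times> real \<times> real"

definition wscale :: "real \<Rightarrow> real4 \<Rightarrow> real4" where
  "wscale c = (\<lambda>(x, y, z, w). (c ^ 3 * x, c * y, c * z, c * w))"

definition wpoint :: "real4 \<Rightarrow> real4 set" where
  "wpoint v = {wscale c v | c. c \<noteq> 0}"

definition wproj_space :: "real4 set set" where
  "wproj_space = wpoint ` (- {0})"

definition wproj_topology :: "real4 set topology" where
  "wproj_topology =
     topology (\<lambda>U. U \<subseteq> wproj_space \<and> open {v. v \<noteq> 0 \<and> wpoint v \<in> U})"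

definition real4_of_rat :: "rat \<times> rat \<times> rat \<times> rat \<Rightarrow> real4" where
  "real4_of_rat = (\<lambda>(x, y, z, w). (of_rat x, of_rat y, of_rat z, of_rat w))"

definition real_points :: "int \<Rightarrow> int \<Rightarrow> real4 set set" where
  "real_points a b = {wpoint v | v. v \<noteq> 0 \<and> solves_eqn a b v}"

definition rational_points :: "int \<Rightarrow> int \<Rightarrow> real4 set set" where
  "rational_points a b = {wpoint (real4_of_rat r) | r. r \<noteq> 0 \<and> solves_eqn a b r}"

lemma openin_wproj_topology:
  "openin wproj_topology U \<longleftrightarrow>
     U \<subseteq> wproj_space \<and> open {v. v \<noteq> 0 \<and> wpoint v \<in> U}"
proof -
  have "istopology (\<lambda>U. U \<subseteq> wproj_space \<and> open {v. v \<noteq> 0 \<and> wpoint v \<in> U})"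
    unfolding istopology_def
  proof (intro conjI allI impI)
    fix S T
    assume S: "S \<subseteq> wproj_space \<and> open {v. v \<noteq> 0 \<and> wpoint v \<in> S}"
      and T: "T \<subseteq> wproj_space \<and> open {v. v \<noteq> 0 \<and> wpoint v \<in> T}"
    show "S \<inter> T \<subseteq> wproj_space" using S by blast
    have "{v. v \<noteq> 0 \<and> wpoint v \<in> S \<inter> T} =
        {v. v \<noteq> 0 \<and> wpoint v \<in> S} \<inter> {v. v \<noteq> 0 \<and> wpoint v \<in> T}"
      by blast
    then show "open {v. v \<noteq> 0 \<and> wpoint v \<in> S \<inter> T}"
      using S T by (simp add: open_Int)
  next
    fix K
    assume K: "\<forall>U\<in>K. U \<subseteq> wproj_space \<and> open {v. v \<noteq> 0 \<and> wpoint v \<in> U}"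
    show "\<Union>K \<subseteq> wproj_space" using K by blast
    have "{v. v \<noteq> 0 \<and> wpoint v \<in> \<Union>K} = (\<Union>U\<in>K. {v. v \<noteq> 0 \<and> wpoint v \<in> U})"
      by blast
    then show "open {v. v \<noteq> 0 \<and> wpoint v \<in> \<Union>K}"
      using K by (metis (mono_tags, lifting) open_UN)
  qed
  then show ?thesis
    by (simp add: wproj_topology_def topology_inverse')
qed

lemma topspace_wproj_topology: "topspace wproj_topology = wproj_space"
proof
  show "topspace wproj_topology \<subseteq> wproj_space"
    using openin_topspace[of wproj_topology] openin_wproj_topology by blast
  have "{v. v \<noteq> 0 \<and> wpoint v \<in> wproj_space} = - {0}"
    by (auto simp: wproj_space_def)
  then have "openin wproj_topology wproj_space"
    by (simp add: openin_wproj_topology open_Compl)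
  then show "wproj_space \<subseteq> topspace wproj_topology"
    by (rule openin_subset)
qed

lemma wscale_1 [simp]: "wscale 1 v = v"
  by (simp add: wscale_def split: prod.splits)

lemma wscale_wscale: "wscale c (wscale d v) = wscale (c * d) v"
  by (simp add: wscale_def power_mult_distrib split: prod.splits)

lemma wscale_eq_0_iff: "c \<noteq> 0 \<Longrightarrow> wscale c v = 0 \<longleftrightarrow> v = 0"
  by (auto simp: wscale_def zero_prod_def split: prod.splits)

lemma wpoint_self: "v \<in> wpoint v"
  unfolding wpoint_def by (auto intro!: exI[of _ 1])

lemma wpoint_eq_iff: "wpoint u = wpoint v \<longleftrightarrow> (\<exists>c. c \<noteq> 0 \<and> u = wscale c v)"
proof
  assume "wpoint u = wpoint v"
  then show "\<exists>c. c \<noteq> 0 \<and> u = wscale c v"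
    using wpoint_self[of u] by (auto simp: wpoint_def)
next
  assume "\<exists>c. c \<noteq> 0 \<and> u = wscale c v"
  then obtain c where c: "c \<noteq> 0" "u = wscale c v" by blast
  have "wscale d v = wscale (d / c) u" for d
    using c by (simp add: wscale_wscale)
  then have "\<exists>d'. wscale d v = wscale d' u \<and> d' \<noteq> 0" if "d \<noteq> 0" for d
    using that c by (metis divide_eq_0_iff)
  moreover have "\<exists>d'. wscale d u = wscale d' v \<and> d' \<noteq> 0" if "d \<noteq> 0" for d
    using that c by (auto simp: wscale_wscale intro!: exI[of _ "d * c"])
  ultimately show "wpoint u = wpoint v"
    unfolding wpoint_def by auto
qed

lemma solves_eqn_wscale: "solves_eqn a b v \<Longrightarrow> solves_eqn a b (wscale c v)"
proof -
  assume "solves_eqn a b v"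
  obtain x y z w where v: "v = (x, y, z, w)" by (cases v)
  have "of_int a * ((c^3*x)^2 - (c*y)^6) = c^6 * (of_int a * (x^2 - y^6))"
    by (simp add: power_mult_distrib algebra_simps flip: power_mult)
  moreover have "of_int b * ((c*z)^6 - (c*w)^6) = c^6 * (of_int b * (z^6 - w^6))"
    by (simp add: power_mult_distrib algebra_simps)
  ultimately show ?thesis
    using \<open>solves_eqn a b v\<close> unfolding v solves_eqn_def wscale_def split by metis
qed

lemma real4_of_rat_eq_0_iff [simp]: "real4_of_rat r = 0 \<longleftrightarrow> r = 0"
  by (auto simp: real4_of_rat_def zero_prod_def split: prod.splits)

lemma solves_eqn_real4_of_rat: "solves_eqn a b (real4_of_rat r) \<longleftrightarrow> solves_eqn a b r"
proof -
  obtain x y z w where r: "r = (x, y, z, w)" by (cases r)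
  have "(of_int a * (of_rat x ^ 2 - of_rat y ^ 6) :: real) = of_rat (of_int a * (x ^ 2 - y ^ 6))"
    "(of_int b * (of_rat z ^ 6 - of_rat w ^ 6) :: real) = of_rat (of_int b * (z ^ 6 - w ^ 6))"
    by (simp_all add: of_rat_mult of_rat_diff of_rat_power)
  then show ?thesis
    by (simp add: r solves_eqn_def real4_of_rat_def)
qed

lemma rational_points_subset: "rational_points a b \<subseteq> real_points a b"
proof
  fix p assume "p \<in> rational_points a b"
  then obtain r where "r \<noteq> 0" "solves_eqn a b r" "p = wpoint (real4_of_rat r)"
    by (auto simp: rational_points_def)
  then show "p \<in> real_points a b"
    unfolding real_points_def using solves_eqn_real4_of_rat real4_of_rat_eq_0_iff by blast
qed

lemma real_points_subset: "real_points a b \<subseteq> wproj_space"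
  by (auto simp: real_points_def wproj_space_def)

lemma wpoint_in_real_points_iff:
  "v \<noteq> 0 \<Longrightarrow> wpoint v \<in> real_points a b \<longleftrightarrow> solves_eqn a b v"
proof
  assume "wpoint v \<in> real_points a b"
  then obtain u where u: "wpoint v = wpoint u" "solves_eqn a b u"
    by (auto simp: real_points_def)
  then obtain c where "v = wscale c u"
    unfolding wpoint_eq_iff by auto
  then show "solves_eqn a b v" using u solves_eqn_wscale by simp
next
  assume "solves_eqn a b v"
  then show "wpoint v \<in> real_points a b" if "v \<noteq> 0"
    unfolding real_points_def using that by blast
qed

text \<open>Density on the surface is the same as density on the affine cone over it.\<close>

lemma dense_iff_dense_cone:
  "subtopology wproj_topology (real_points a b) closure_of rational_points a b = real_points a b
   \<longleftrightarrow> {v. solves_eqn a b v} \<subseteq> closure (real4_of_rat ` {r. solves_eqn a b r})"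
  (is "?L \<longleftrightarrow> ?R")
proof -
  have "?L \<longleftrightarrow> real_points a b \<subseteq> wproj_topology closure_of rational_points a b"
    using rational_points_subset[of a b]
    by (auto simp: closure_of_subtopology Int_absorb1)
  also have "\<dots> \<longleftrightarrow> ?R"
  proof
    assume L: "real_points a b \<subseteq> wproj_topology closure_of rational_points a b"
    show ?R
    proof (intro subsetI)
      fix v :: real4 assume "v \<in> {v. solves_eqn a b v}"
      then have v: "solves_eqn a b v" by simp
      show "v \<in> closure (real4_of_rat ` {r. solves_eqn a b r})"
      proof (cases "v = 0")
        case True
        then have "v = real4_of_rat 0" by simp
        moreover have "solves_eqn a b (0 :: rat \<times> rat \<times> rat \<times> rat)"
          by (simp add: solves_eqn_def zero_prod_def)
        ultimately have "v \<in> real4_of_rat ` {r. solves_eqn a b r}"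
          by (metis imageI mem_Collect_eq)
        then show ?thesis by (rule subsetD[OF closure_subset])
      next
        case False
        show ?thesis
          unfolding closure_iff_nhds_not_empty
        proof (intro allI impI)
          fix A N :: "real4 set"
          assume N: "N \<subseteq> A" "open N" "v \<in> N"
          define U where "U = wpoint ` (N - {0})"
          have eq: "{u. u \<noteq> 0 \<and> wpoint u \<in> U} = (\<Union>c\<in>-{0}. wscale c -` (N - {0}))"
          proof (intro set_eqI iffI)
            fix u assume "u \<in> {u. u \<noteq> 0 \<and> wpoint u \<in> U}"
            then obtain n where n: "n \<in> N - {0}" "wpoint n = wpoint u"
              unfolding U_def by (metis (no_types, lifting) imageE mem_Collect_eq)
            then obtain c where "c \<noteq> 0" "n = wscale c u"
              using wpoint_eq_iff by blast
            then show "u \<in> (\<Union>c\<in>-{0}. wscale c -` (N - {0}))" using n by auto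
          next
            fix u assume "u \<in> (\<Union>c\<in>-{0}. wscale c -` (N - {0}))"
            then obtain c where c: "c \<noteq> 0" "wscale c u \<in> N - {0}" by auto
            then have "wpoint (wscale c u) = wpoint u" using wpoint_eq_iff by blast
            then have "wpoint u \<in> U" using c(2) unfolding U_def by (metis imageI)
            moreover have "u \<noteq> 0" using c wscale_eq_0_iff by auto
            ultimately show "u \<in> {u. u \<noteq> 0 \<and> wpoint u \<in> U}" by simp
          qed
          have cont: "continuous_on UNIV (wscale c)" for c
            unfolding wscale_def case_prod_unfold by (intro continuous_intros)
          have "open (wscale c -` (N - {0}))" for c
            using cont N(2) by (intro open_vimage) (auto intro: open_delete)
          then have "open {u. u \<noteq> 0 \<and> wpoint u \<in> U}"
            unfolding eq by (intro open_UN ballI)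
          moreover have "U \<subseteq> wproj_space" by (auto simp: U_def wproj_space_def)
          ultimately have "openin wproj_topology U" by (simp add: openin_wproj_topology)
          moreover have "wpoint v \<in> U" using N False by (auto simp: U_def)
          moreover have "wpoint v \<in> wproj_topology closure_of rational_points a b"
            using L v wpoint_in_real_points_iff[OF False] by (meson subsetD)
          ultimately obtain p where "p \<in> rational_points a b" "p \<in> U"
            by (auto simp: in_closure_of)
          moreover from \<open>p \<in> U\<close> obtain n where n: "n \<in> N" and "p = wpoint n"
            unfolding U_def by (metis DiffD1 imageE)
          ultimately obtain r where r: "solves_eqn a b r"
            and "wpoint n = wpoint (real4_of_rat r)"
            by (auto simp: rational_points_def)
          then obtain c where c: "n = wscale c (real4_of_rat r)"
            using wpoint_eq_iff by blast
          define M where "M = (\<lambda>d. wscale d (real4_of_rat r)) -` N"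
          have "continuous_on UNIV (\<lambda>d. wscale d (real4_of_rat r))"
            unfolding wscale_def case_prod_unfold by (intro continuous_intros)
          then have "open M" unfolding M_def using N(2) by (intro open_vimage)
          moreover have "c \<in> M" using c n by (simp add: M_def)
          ultimately obtain e where e: "e > 0" "\<forall>d. dist d c < e \<longrightarrow> d \<in> M"
            by (auto simp: open_dist)
          obtain q where q: "c < of_rat q" "of_rat q < c + e"
            using of_rat_dense[of c "c + e"] e(1) by auto
          then have "of_rat q \<in> M" using e(2) by (auto simp: dist_real_def)
          then have inN: "wscale (of_rat q) (real4_of_rat r) \<in> N" by (simp add: M_def)
          obtain x y z w where xyzw: "r = (x, y, z, w)" by (cases r)
          have sc: "wscale (of_rat q) (real4_of_rat r) =
              real4_of_rat (q ^ 3 * x, q * y, q * z, q * w)"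
            by (simp add: xyzw wscale_def real4_of_rat_def of_rat_mult of_rat_power)
          have "solves_eqn a b (q ^ 3 * x, q * y, q * z, q * w)"
            using r solves_eqn_wscale sc solves_eqn_real4_of_rat by metis
          then have "wscale (of_rat q) (real4_of_rat r) \<in> real4_of_rat ` {r. solves_eqn a b r}"
            unfolding sc by (intro imageI CollectI)
          then show "real4_of_rat ` {r. solves_eqn a b r} \<inter> A \<noteq> {}"
            using inN N(1) by blast
        qed
      qed
    qed
  next
    assume R: ?R
    show "real_points a b \<subseteq> wproj_topology closure_of rational_points a b"
    proof
      fix p assume p: "p \<in> real_points a b"
      then obtain v where v: "v \<noteq> 0" "solves_eqn a b v" "p = wpoint v"
        by (auto simp: real_points_def)
      show "p \<in> wproj_topology closure_of rational_points a b"
        unfolding in_closure_of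
      proof (intro conjI allI impI)
        show "p \<in> topspace wproj_topology"
          using p real_points_subset topspace_wproj_topology by blast
        fix U assume U: "p \<in> U \<and> openin wproj_topology U"
        then have op: "open {u. u \<noteq> 0 \<and> wpoint u \<in> U}"
          by (simp add: openin_wproj_topology)
        have "v \<in> closure (real4_of_rat ` {r. solves_eqn a b r})" using R v by auto
        then have "real4_of_rat ` {r. solves_eqn a b r} \<inter> {u. u \<noteq> 0 \<and> wpoint u \<in> U} \<noteq> {}"
          using op U v unfolding closure_iff_nhds_not_empty by blast
        then obtain r where "solves_eqn a b r" "real4_of_rat r \<noteq> 0"
          "wpoint (real4_of_rat r) \<in> U"
          by blast
        then show "\<exists>y. y \<in> rational_points a b \<and> y \<in> U"
          unfolding rational_points_def using real4_of_rat_eq_0_iff by blast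
      qed
    qed
  qed
  finally show ?thesis .
qed

end

theory Submission
  imports Defs
begin

text \<open>Put $c = b/a$. A point of the surface with
  $x - y^3 = c t^3 (z^3 - w^3)$ and $t^3 (x + y^3) = z^3 + w^3$ lies on the cubic curve
  $2 (t y)^3 = (1 - c t^6) z^3 + (1 + c t^6) w^3$, which contains $(t y, z, w) = (1, 1, 1)$.
  The tangent there meets the curve again in a point that is polynomial in $t$; this gives the
  polynomial solutions.

  For density, the real points of all these cubics are identified with those of one fixed cubic by
  taking cubes of the coordinates. The tangent map $P \mapsto -2P$ expands the invariant
  differential by 2, so the iterated preimages of any point are dense. The base point
  $(1, 1, 1)$ corresponds to the parameter $-2/(1 + c t^6)$, which moves with $t$. Hence,
  arbitrarily close to a given $t$, some iterate of the base point hits any prescribed real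
  point; by continuity a nearby rational $t$ gives a rational point close to it.\<close>

section \<open>Polynomial solutions\<close>

text \<open>The constants arise from $t = 3 a s$, which makes all coordinates integral and allows
  to divide $y$, $z$, $w$ by 3 and $x$ by 27.\<close>

lemma polynomial_solution:
  fixes a b s :: "'a::idom"
  defines "u \<equiv> 243 * b * a ^ 5 * s ^ 6"
  defines "y \<equiv> - 162 * b * a ^ 4 * s ^ 5"
  defines "x \<equiv> y ^ 3 + 27 * b * a\<^sup>2 * s ^ 3 * ((u + 1) ^ 3 - (u - 1) ^ 3)"
  shows "a * (x\<^sup>2 - y ^ 6) = b * ((u + 1) ^ 6 - (u - 1) ^ 6)"
proof -
  define D where "D = (u + 1) ^ 3 - (u - 1) ^ 3"
  have x: "x = y ^ 3 + 27 * b * a\<^sup>2 * s ^ 3 * D"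
    by (simp only: x_def D_def)
  \<comment> \<open>With \<open>t = 3 * a * s\<close> one has \<open>c * t ^ 6 = 3 * u\<close>, and
    \<open>27 * a ^ 3 * s ^ 3\<close> is \<open>t ^ 3\<close>. The tangent at (1, 1, 1) then meets
    the cubic again in \<open>(t * y, z, w) = (- 2 * u, u + 1, u - 1)\<close>.\<close>
  have "27 * a ^ 3 * s ^ 3 * (x + y ^ 3) = 2 * (3 * a * s * y) ^ 3 + 3 * u * D"
    unfolding x u_def by algebra
  also have "3 * a * s * y = - 2 * u"
    unfolding y_def u_def by algebra
  also have "2 * (- 2 * u) ^ 3 + 3 * u * D = (u + 1) ^ 3 + (u - 1) ^ 3"
    unfolding D_def by algebra
  finally have sum: "27 * a ^ 3 * s ^ 3 * (x + y ^ 3) = (u + 1) ^ 3 + (u - 1) ^ 3" .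
  have "a * (x\<^sup>2 - y ^ 6) = a * (x - y ^ 3) * (x + y ^ 3)"
    by algebra
  also have "x - y ^ 3 = 27 * b * a\<^sup>2 * s ^ 3 * D"
    by (simp add: x)
  also have "a * (27 * b * a\<^sup>2 * s ^ 3 * D) * (x + y ^ 3)
      = b * D * (27 * a ^ 3 * s ^ 3 * (x + y ^ 3))"
    by algebra
  also have "\<dots> = b * ((u + 1) ^ 6 - (u - 1) ^ 6)"
    unfolding sum D_def by algebra
  finally show ?thesis .
qed

text \<open>Monomials of different degrees, inserted for \<open>s\<close>, give different
  \<open>u\<close>. The coordinates are coprime because \<open>z\<close> and \<open>w\<close>
  already are: a common divisor divides \<open>z - w = 2\<close>, hence is constant, and
  \<open>z\<close> has the value 1 at 0.\<close>

lemma infinite_polynomial_solutions: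
  fixes a b :: int
  assumes a: "a \<noteq> 0" and b: "b \<noteq> 0"
  shows "infinite {(x :: int poly, y :: int poly, z :: int poly, w :: int poly).
           solves_eqn a b (x, y, z, w) \<and> \<not> trivial_sol a b (x, y, z, w) \<and>
           gcd x (gcd y (gcd z w)) = 1}" (is "infinite ?S")
proof -
  \<comment> \<open>The exponent is positive so that \<open>u\<close> vanishes at 0; the coprimality
    rests on this.\<close>
  define s :: "nat \<Rightarrow> int poly" where "s n = monom 1 (Suc n)" for n
  define u where "u n = 243 * of_int b * of_int a ^ 5 * s n ^ 6" for n
  define y where "y n = - 162 * of_int b * of_int a ^ 4 * s n ^ 5" for n
  define x where
    "x n = y n ^ 3 + 27 * of_int b * (of_int a)\<^sup>2 * s n ^ 3 * ((u n + 1) ^ 3 - (u n - 1) ^ 3)" for n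
  define q where "q n = (x n, y n, u n + 1, u n - 1)" for n
  have u0: "poly (u n) 0 = 0" and u1: "poly (u n) 1 = 243 * b * a ^ 5" for n
    by (simp_all add: u_def s_def poly_monom)
  have "q n \<in> ?S" for n
  proof -
    have "solves_eqn a b (q n)"
      using polynomial_solution[of "of_int a" "of_int b" "s n"]
      by (simp add: solves_eqn_def q_def x_def y_def u_def)
    moreover have "\<not> trivial_sol a b (q n)"
    proof
      assume "trivial_sol a b (q n)"
      then have "(u n + 1) ^ 6 - (u n - 1) ^ 6 = 0"
        using b by (simp add: trivial_sol_def q_def)
      also have "(u n + 1) ^ 6 - (u n - 1) ^ 6 = u n * (12 + 40 * (u n)\<^sup>2 + 12 * u n ^ 4)"
        by algebra
      \<comment> \<open>Evaluation at 1 turns this product into a nonzero integer times a positive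
        one.\<close>
      finally have "poly (u n * (12 + 40 * (u n)\<^sup>2 + 12 * u n ^ 4)) 1 = 0"
        by (metis poly_0)
      moreover define k where "k = 243 * b * a ^ 5"
      ultimately have "k * (12 + 40 * k\<^sup>2 + 12 * k ^ 4) = 0"
        using u1[of n] by simp
      moreover have "k \<noteq> 0" using a b by (simp add: k_def)
      moreover have "k ^ 4 = (k\<^sup>2)\<^sup>2" by simp
      then have "12 + 40 * k\<^sup>2 + 12 * k ^ 4 > 0"
        using zero_le_power2[of k] zero_le_power2[of "k\<^sup>2"] by linarith
      ultimately show False by simp
    qed
    moreover have "gcd (u n + 1) (u n - 1) = 1"
    proof -
      define d where "d = gcd (u n + 1) (u n - 1)"
      have "d dvd (u n + 1) - (u n - 1)" 
        unfolding d_def by (intro dvd_diff gcd_dvd1 gcd_dvd2)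
      then have d2: "d dvd [:2:]" by (simp add: numeral_poly)
      then have "degree d = 0" using dvd_imp_degree_le[OF d2] by simp
      then obtain e where e: "d = [:e:]" by (rule degree_eq_zeroE)
      have "d dvd u n + 1" by (simp add: d_def)
      then obtain r where "u n + 1 = d * r" ..
      then have "poly (u n + 1) 0 = poly (d * r) 0" by simp
      then have "1 = e * poly r 0" by (simp add: e u0)
      then have "is_unit e" by (metis dvd_triv_left)
      then have "is_unit d" by (simp add: e is_unit_const_poly_iff)
      then show ?thesis by (simp only: d_def is_unit_gcd_iff)
    qed
    ultimately show "q n \<in> ?S"
      by (simp add: q_def)
  qed
  moreover have "inj q"
  proof (rule injI)
    fix m n assume "q m = q n"
    then have "s m ^ 6 = s n ^ 6"
      using a b by (simp add: q_def u_def)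
    then have "degree (s m ^ 6) = degree (s n ^ 6)" by simp
    then show "m = n"
      by (simp add: s_def monom_power degree_monom_eq)
  qed
  then have "infinite (range q)"
    by (rule range_inj_infinite)
  ultimately show ?thesis
    by (meson image_subset_iff infinite_super)
qed

section \<open>Dynamics of the tangent map\<close>

text \<open>Tangent at a point: the curve $A X^3 + B Y^3 + C Z^3 = 0$ is mapped to itself by
  $(X, Y, Z) \mapsto (X (B Y^3 - C Z^3), Y (C Z^3 - A X^3), Z (A X^3 - B Y^3))$. In the real
  coordinate $m = A X^3 / (C Z^3)$, which no longer depends on the coefficients, it is the
  following map; its pole is $-1/2$.\<close>

definition tangent_map :: "real \<Rightarrow> real" where
  "tangent_map m = - m * (m + 2) ^ 3 / (2 * m + 1) ^ 3"

text \<open>In the coordinates of the cubic, \<open>1 + m\<close> is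
  \<open>- B Y^3 / (C Z^3)\<close>; so it is multiplied by the cube of the factor by which
  \<open>Y / Z\<close> changes.\<close>

lemma one_plus_tangent_map:
  "2 * m + 1 \<noteq> 0 \<Longrightarrow> 1 + tangent_map m = (1 + m) * (1 - m) ^ 3 / (2 * m + 1) ^ 3"
proof -
  assume m: "2 * m + 1 \<noteq> 0"
  then have "1 + tangent_map m = ((2 * m + 1) ^ 3 - m * (m + 2) ^ 3) / (2 * m + 1) ^ 3"
    by (simp add: tangent_map_def diff_divide_distrib)
  also have "(2 * m + 1) ^ 3 - m * (m + 2) ^ 3 = (1 + m) * (1 - m) ^ 3"
    by algebra
  finally show ?thesis .
qed

text \<open>The derivative is written as -2 times a square \<open>r ^ 2\<close> because the tangent
  map multiplies \<open>m * (1 + m)\<close> by \<open>- r ^ 3\<close> with the same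
  \<open>r\<close>.\<close>

lemma tangent_map_has_real_derivative:
  assumes "2 * m + 1 \<noteq> 0"
  shows "(tangent_map has_real_derivative - 2 * ((m + 2) * (1 - m) / (2 * m + 1)\<^sup>2)\<^sup>2) (at m)"
proof -
  have "((\<lambda>m. - m * (m + 2) ^ 3) has_real_derivative - ((m + 2) ^ 3) - 3 * m * (m + 2)\<^sup>2) (at m)"
    by (auto intro!: derivative_eq_intros)
  moreover have "((\<lambda>m. (2 * m + 1) ^ 3) has_real_derivative 6 * (2 * m + 1)\<^sup>2) (at m)"
    by (auto intro!: derivative_eq_intros)
  ultimately have "((\<lambda>m. - m * (m + 2) ^ 3 / (2 * m + 1) ^ 3) has_real_derivative
      ((- ((m + 2) ^ 3) - 3 * m * (m + 2)\<^sup>2) * (2 * m + 1) ^ 3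
        - - m * (m + 2) ^ 3 * (6 * (2 * m + 1)\<^sup>2)) / ((2 * m + 1) ^ 3 * (2 * m + 1) ^ 3)) (at m)"
    using assms by (intro DERIV_divide) auto
  moreover have "((- ((m + 2) ^ 3) - 3 * m * (m + 2)\<^sup>2) * (2 * m + 1) ^ 3
        - - m * (m + 2) ^ 3 * (6 * (2 * m + 1)\<^sup>2)) / ((2 * m + 1) ^ 3 * (2 * m + 1) ^ 3)
      = (- 2 * ((m + 2) * (1 - m))\<^sup>2 * (2 * m + 1)\<^sup>2) / ((2 * m + 1) ^ 4 * (2 * m + 1)\<^sup>2)"
    by (rule arg_cong2[where f = "(/)"]; algebra)
  moreover have "\<dots> = - 2 * ((m + 2) * (1 - m) / (2 * m + 1)\<^sup>2)\<^sup>2"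
    using assms by (subst nonzero_mult_divide_mult_cancel_right) (simp_all add: power_divide)
  ultimately show ?thesis
    unfolding tangent_map_def[abs_def] by simp
qed

lemma isCont_tangent_map: "2 * m + 1 \<noteq> 0 \<Longrightarrow> isCont tangent_map m"
  using tangent_map_has_real_derivative DERIV_isCont by blast

lemma tangent_map_eq_iff:
  assumes "2 * m + 1 \<noteq> 0"
  shows "tangent_map m = k \<longleftrightarrow> m * (m + 2) ^ 3 + k * (2 * m + 1) ^ 3 = 0"
  using assms unfolding tangent_map_def by (auto simp: divide_simps)

section \<open>Surjectivity of the tangent map on each side of its pole\<close>

text \<open>With denominators cleared, a preimage of \<open>k\<close> is a root of a quartic that is
  negative at the pole and nonnegative far to the right. Having preimages on both sides of the pole
  allows choosing one on the same side as a given point.\<close>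

lemma tangent_map_onto_right: "\<exists>m > -1/2. tangent_map m = k"
proof -
  define p where "p m = m * (m + 2) ^ 3 + k * (2 * m + 1) ^ 3" for m
  \<comment> \<open>This bound works because \<open>(2 * M + 1) ^ 3\<close> is at most
    \<open>8 * (M + 2) ^ 3\<close>.\<close>
  define M where "M = 8 * \<bar>k\<bar>"
  have M0: "M \<ge> 0" by (simp add: M_def)
  have "(2 * M + 1) ^ 3 \<le> (2 * (M + 2)) ^ 3"
    using M0 by (intro power_mono) auto
  then have "\<bar>k\<bar> * (2 * M + 1) ^ 3 \<le> \<bar>k\<bar> * (2 * (M + 2)) ^ 3"
    by (intro mult_left_mono) auto
  also have "\<dots> = M * (M + 2) ^ 3" by (simp only: M_def power_mult_distrib) simp
  finally have "\<bar>k * (2 * M + 1) ^ 3\<bar> \<le> M * (M + 2) ^ 3"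
    using M0 by (simp add: abs_mult)
  then have "p M \<ge> 0" by (simp add: p_def)
  moreover have "p (-1/2) < 0" by (simp add: p_def power3_eq_cube)
  moreover have "\<forall>m. -1/2 \<le> m \<and> m \<le> M \<longrightarrow> isCont p m"
    unfolding p_def[abs_def] by (auto intro!: continuous_intros)
  ultimately obtain m where m: "-1/2 \<le> m" "p m = 0"
    using IVT[of p "-1/2" 0 M] M0 by force
  then have "m \<noteq> -1/2" using \<open>p (-1/2) < 0\<close> by auto
  then have "m > -1/2" using m by simp
  moreover from this have "tangent_map m = k"
    using m tangent_map_eq_iff[of m k] by (simp add: p_def)
  ultimately show ?thesis by blast
qed

lemma tangent_map_onto_left: "\<exists>m < -1/2. tangent_map m = k"
proof -
  define p where "p m = m * (m + 2) ^ 3 + k * (2 * m + 1) ^ 3" for m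
  \<comment> \<open>The bound 3 gives \<open>2 * n + 3 \<le> 3 * n\<close>, whose cube produces the
    factor 27.\<close>
  define n where "n = 27 * \<bar>k\<bar> + 3"
  have n3: "n \<ge> 3" by (simp add: n_def)
  have "(2 * n + 3) ^ 3 \<le> (3 * n) ^ 3"
    using n3 by (intro power_mono) auto
  then have "\<bar>k\<bar> * (2 * n + 3) ^ 3 \<le> \<bar>k\<bar> * (3 * n) ^ 3"
    by (intro mult_left_mono) auto
  also have "\<dots> = (27 * \<bar>k\<bar>) * n ^ 3" by (simp add: power_mult_distrib)
  also have "\<dots> \<le> (n + 2) * n ^ 3" using n3 by (intro mult_right_mono) (auto simp: n_def)
  finally have "\<bar>k * (2 * n + 3) ^ 3\<bar> \<le> (n + 2) * n ^ 3"
    using n3 by (simp add: abs_mult)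
  moreover have "p (- 2 - n) = (n + 2) * n ^ 3 - k * (2 * n + 3) ^ 3"
    unfolding p_def by algebra
  ultimately have "p (- 2 - n) \<ge> 0" by simp
  moreover have "p (-1/2) < 0" by (simp add: p_def power3_eq_cube)
  moreover have "\<forall>m. - 2 - n \<le> m \<and> m \<le> -1/2 \<longrightarrow> isCont p m"
    unfolding p_def[abs_def] by (auto intro!: continuous_intros)
  ultimately obtain m where m: "m \<le> -1/2" "p m = 0"
    using IVT2[of p "-1/2" 0 "- 2 - n"] n3 by force
  then have "m \<noteq> -1/2" using \<open>p (-1/2) < 0\<close> by auto
  then have "m < -1/2" using m by simp
  moreover from this have "tangent_map m = k"
    using m tangent_map_eq_iff[of m k] by (simp add: p_def)
  ultimately show ?thesis by blast
qed

text \<open>The invariant differential of the elliptic curve; the tangent map is multiplication by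
  $-2$ and therefore multiplies it by $-2$.\<close>

definition invariant_density :: "real \<Rightarrow> real" where
  "invariant_density m = \<bar>m * (1 + m)\<bar> powr (-2/3)"

text \<open>The tangent map multiplies \<open>m * (1 + m)\<close> by \<open>- r ^ 3\<close>, so the
  power -2/3 contributes \<open>r ^ (-2)\<close>, which cancels the square in the derivative. The
  points -2 and 1 are the zeros of \<open>r\<close>.\<close>

lemma invariant_density_tangent_map:
  assumes "2 * m + 1 \<noteq> 0" "m \<noteq> -2" "m \<noteq> 1"
  shows "invariant_density (tangent_map m) * ((m + 2) * (1 - m) / (2 * m + 1)\<^sup>2)\<^sup>2 = invariant_density m"
proof -
  define r where "r = (m + 2) * (1 - m) / (2 * m + 1)\<^sup>2"
  have r: "r \<noteq> 0" using assms by (auto simp: r_def)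
  have "tangent_map m * (1 + tangent_map m) = - (m * (1 + m)) * r ^ 3"
    using assms(1) unfolding one_plus_tangent_map[OF assms(1)] unfolding tangent_map_def r_def
    by (simp add: power_divide power_mult_distrib flip: power_mult power_add)
  then have "invariant_density (tangent_map m) = (\<bar>m * (1 + m)\<bar> * \<bar>r\<bar> ^ 3) powr (-2/3)"
    by (simp add: invariant_density_def abs_mult power_abs)
  also have "\<dots> = invariant_density m * (\<bar>r\<bar> powr 3) powr (-2/3)"
    using r by (simp add: invariant_density_def powr_mult)
  also have "(\<bar>r\<bar> powr 3) powr (-2/3) = inverse (r\<^sup>2)"
    unfolding powr_powr using r by (simp add: powr_minus)
  finally show ?thesis
    using r by (simp add: r_def)
qed

section \<open>Integrability of the invariant density and its antiderivative\<close>

text \<open>The reflection exchanges the terms \<open>A X^3\<close> and \<open>B Y^3\<close> of the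
  cubic. It reduces the integrability estimate to \<open>m \<ge> -1/2\<close>.\<close>

lemma invariant_density_reflect: "invariant_density (- 1 - m) = invariant_density m"
proof -
  have "(- 1 - m) * (1 + (- 1 - m)) = m * (1 + m)" by algebra
  then show ?thesis by (simp only: invariant_density_def)
qed

text \<open>The singularities at 0 and -1 have exponent -2/3 and the decay at infinity has exponent
  -4/3, both integrable. The majorant is built on the positive half-line, made symmetric about 0,
  and then added to its reflection about -1/2.\<close>

lemma integrable_invariant_density: "integrable lborel invariant_density"
proof -
  \<comment> \<open>The factor 2 bounds \<open>\<bar>1 + m\<bar> powr (-2/3)\<close> for
    \<open>m \<ge> -1/2\<close>.\<close>
  define D where "D m = indicator {0..1} m *\<^sub>R (2 * m powr (-2/3))
      + indicator {1..} m *\<^sub>R (m powr (-4/3))" for m :: real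
  have "(\<lambda>m::real. m powr (-2/3)) absolutely_integrable_on {0..1}"
    using integrable_on_powr_from_0[of "-2/3" 1]
    by (subst absolutely_integrable_on_iff_nonneg) auto
  from integrable_mult_right[OF this[unfolded set_integrable_def], of 2]
  have "integrable lborel (\<lambda>m::real. indicator {0..1} m *\<^sub>R (2 * m powr (-2/3)))"
    by (subst (asm) integrable_completion) (auto simp: mult_ac)
  moreover have "(\<lambda>m::real. m powr (-4/3)) absolutely_integrable_on {1..}"
    using has_integral_powr_to_inf[of "-4/3" 1]
    by (subst absolutely_integrable_on_iff_nonneg) (auto simp: integrable_on_def)
  then have "integrable lborel (\<lambda>m::real. indicator {1..} m *\<^sub>R (m powr (-4/3)))"
    unfolding set_integrable_def by (subst (asm) integrable_completion) auto
  ultimately have D: "integrable lborel D"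
    unfolding D_def by (intro Bochner_Integration.integrable_add)
  define E where "E m = D (0 + (-1) * m) + D m" for m
  have E: "integrable lborel E"
    unfolding E_def
    by (intro Bochner_Integration.integrable_add D lborel_integrable_real_affine) auto
  have "integrable lborel (\<lambda>m. E m + E ((-1) + (-1) * m))"
    by (intro Bochner_Integration.integrable_add E lborel_integrable_real_affine) auto
  moreover have "invariant_density \<in> borel_measurable lborel"
    unfolding invariant_density_def[abs_def] by measurable
  moreover have nonneg: "E m \<ge> 0" for m
    by (auto simp: E_def D_def)
  have bound: "invariant_density m \<le> E m" if m: "m \<ge> -1/2" for m
  proof (cases "m = 0")
    \<comment> \<open>Here \<open>0 powr (-2/3)\<close> has the default value 0.\<close>
    case True
    then show ?thesis using nonneg[of 0] by (simp add: invariant_density_def)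
  next
    case False
    have *: "invariant_density m = \<bar>m\<bar> powr (-2/3) * \<bar>1 + m\<bar> powr (-2/3)"
      by (simp add: invariant_density_def abs_mult powr_mult)
    show ?thesis
    proof (cases "m \<le> 1")
      case True
      have "\<bar>1 + m\<bar> powr (-2/3) \<le> (1/2) powr (-2/3)"
        using m by (intro powr_mono2') auto
      also have "\<dots> = 2 powr (2/3)" by (simp add: powr_minus powr_divide)
      also have "\<dots> \<le> 2 powr 1" by (intro powr_mono) auto
      finally have "invariant_density m \<le> \<bar>m\<bar> powr (-2/3) * 2"
        unfolding * by (intro mult_left_mono) auto
      also have "\<dots> \<le> E m"
        using m True by (cases "m \<ge> 0") (auto simp: E_def D_def indicator_def)
      finally show ?thesis .
    next
      case False
      have "\<bar>1 + m\<bar> powr (-2/3) \<le> \<bar>m\<bar> powr (-2/3)"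
        using False by (intro powr_mono2') auto
      then have "invariant_density m \<le> \<bar>m\<bar> powr (-2/3) * \<bar>m\<bar> powr (-2/3)"
        unfolding * by (intro mult_left_mono) auto
      also have "\<dots> = \<bar>m\<bar> powr (-4/3)" by (simp flip: powr_add)
      also have "\<dots> \<le> E m" using False by (auto simp: E_def D_def indicator_def)
      finally show ?thesis .
    qed
  qed
  have "invariant_density m \<le> E m + E ((-1) + (-1) * m)" for m
  proof (cases "m \<ge> -1/2")
    case True
    then show ?thesis using bound[of m] nonneg[of "(-1) + (-1) * m"] by linarith
  next
    case False
    then show ?thesis
      using bound[of "- 1 - m"] nonneg[of m] invariant_density_reflect[of m] by simp
  qed
  moreover have "invariant_density m \<ge> 0" for m by (simp add: invariant_density_def)
  ultimately show ?thesis
    using nonneg by (elim Bochner_Integration.integrable_bound) auto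
qed


text \<open>Integrating from minus infinity gives a real elliptic logarithm \<open>\<Theta>\<close>.
  Its total variation is finite by integrability, and it stays continuous at the singularities 0 and
  -1 of its derivative.\<close>

lemma invariant_density_antiderivative:
  obtains \<Theta> :: "real \<Rightarrow> real" and T :: real where
    "\<And>x y. \<bar>\<Theta> x - \<Theta> y\<bar> \<le> T"
    "strict_mono \<Theta>"
    "continuous_on UNIV \<Theta>"
    "\<And>x. x \<noteq> 0 \<Longrightarrow> x \<noteq> -1 \<Longrightarrow> (\<Theta> has_real_derivative invariant_density x) (at x)"
proof -
  define \<Theta> where "\<Theta> x = integral {..x} invariant_density" for x
  define T where "T = integral UNIV invariant_density"
  have nonneg: "invariant_density x \<ge> 0" for x by (simp add: invariant_density_def)
  have int: "invariant_density integrable_on S" if "S \<in> sets borel" for S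
    using integrable_mult_indicator[of S lborel invariant_density] that integrable_invariant_density
    by (intro set_borel_integral_eq_integral(1)) (simp add: set_integrable_def)
  have split: "\<Theta> y = \<Theta> x + integral {x..y} invariant_density" if "x \<le> y" for x y
  proof -
    have "(invariant_density has_integral \<Theta> x + integral {x..y} invariant_density) ({..x} \<union> {x..y})"
    proof (rule has_integral_Un)
      have "{..x} \<inter> {x..y} = {x}" using that by auto
      then show "negligible ({..x} \<inter> {x..y})" by simp
    qed (auto simp: \<Theta>_def intro!: integrable_integral int)
    moreover have "{..x} \<union> {x..y} = {..y}" using that by auto
    ultimately show ?thesis by (simp add: \<Theta>_def integral_unique)
  qed
  have mono: "\<Theta> x \<le> \<Theta> y" if "x \<le> y" for x y
    using split[OF that] integral_nonneg[of invariant_density "{x..y}"] int nonneg by simp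
  have deriv: "(\<Theta> has_real_derivative invariant_density x) (at x)" if "x \<noteq> 0" "x \<noteq> -1" for x
  proof -
    have "isCont invariant_density x"
      using that unfolding invariant_density_def[abs_def] by (intro continuous_intros) auto
    then have "continuous (at x within ({x - 1..x + 1} - {})) invariant_density"
      by (rule continuous_at_imp_continuous_at_within)
    then have "((\<lambda>u. integral {x - 1..u} invariant_density) has_vector_derivative invariant_density x)
        (at x within ({x - 1..x + 1} - {}))"
      by (rule integral_has_vector_derivative_continuous_at[rotated 3]) (auto intro: int)
    moreover have "at x within {x - 1..x + 1} = at x"
      by (rule at_within_interior) auto
    ultimately have "((\<lambda>u. \<Theta> (x - 1) + integral {x - 1..u} invariant_density)
        has_real_derivative invariant_density x) (at x)"
      by (auto simp: has_real_derivative_iff_has_vector_derivative intro!: derivative_eq_intros)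
    moreover have "\<forall>\<^sub>F u in nhds x. u \<in> {x - 1<..}"
      by (rule eventually_nhds_in_open) auto
    then have "\<forall>\<^sub>F u in nhds x. \<Theta> u = \<Theta> (x - 1) + integral {x - 1..u} invariant_density"
      by eventually_elim (simp flip: split)
    then have "(\<Theta> has_real_derivative invariant_density x) (at x) \<longleftrightarrow>
        ((\<lambda>u. \<Theta> (x - 1) + integral {x - 1..u} invariant_density)
          has_real_derivative invariant_density x) (at x)"
      by (rule DERIV_cong_ev[OF refl _ refl])
    ultimately show ?thesis by simp
  qed
  have cont: "isCont \<Theta> x" for x
  proof -
    have "continuous_on {x - 1..x + 1} (\<lambda>u. \<Theta> (x - 1) + integral {x - 1..u} invariant_density)"
      by (intro continuous_intros indefinite_integral_continuous_1 int) auto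
    then have "continuous_on {x - 1..x + 1} \<Theta>"
      by (rule continuous_on_eq) (simp flip: split)
    then show ?thesis
      by (rule continuous_on_interior) simp
  qed
  have "strict_mono \<Theta>"
  proof (rule strict_monoI)
    fix x y :: real assume "x < y"
    \<comment> \<open>A subinterval free of both singularities has a positive derivative
      throughout.\<close>
    obtain u v where uv: "x \<le> u" "u < v" "v \<le> y" "\<And>s. u \<le> s \<Longrightarrow> s \<le> v \<Longrightarrow> s \<noteq> 0 \<and> s \<noteq> -1"
    proof -
      consider "x \<ge> 0" | "x < 0" "x \<ge> -1" | "x < -1" by linarith
      then show ?thesis
      proof cases
        case 1
        then show ?thesis using \<open>x < y\<close> by (intro that[of "(x + y) / 2" y]) auto
      next
        case 2
        define v where "v = min y (x / 2)"
        have "x < v" "v < 0" "v \<le> y" using 2 \<open>x < y\<close> by (auto simp: v_def min_def)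
        then show ?thesis using 2 by (intro that[of "(x + v) / 2" v]) auto
      next
        case 3
        define v where "v = min y ((x - 1) / 2)"
        have "x < v" "v < -1" "v \<le> y" using 3 \<open>x < y\<close> by (auto simp: v_def min_def)
        then show ?thesis by (intro that[of x v]) auto
      qed
    qed
    have "\<Theta> u < \<Theta> v"
    proof (rule DERIV_pos_imp_increasing[OF uv(2)])
      fix s assume "u \<le> s" "s \<le> v"
      then have "s \<noteq> 0" "s \<noteq> -1" using uv(4) by auto
      then show "\<exists>d. (\<Theta> has_real_derivative d) (at s) \<and> d > 0"
        using deriv by (intro exI[of _ "invariant_density s"]) (auto simp: invariant_density_def)
    qed
    then show "\<Theta> x < \<Theta> y" using mono[OF uv(1)] mono[OF uv(3)] by linarith
  qed
  moreover have "0 \<le> \<Theta> x \<and> \<Theta> x \<le> T" for x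
    unfolding \<Theta>_def T_def using int nonneg
    by (auto intro!: integral_nonneg integral_subset_le)
  then have "\<bar>\<Theta> x - \<Theta> y\<bar> \<le> T" for x y
    by (smt (verit))
  moreover have "continuous_on UNIV \<Theta>"
    using cont by (simp add: continuous_on_eq_continuous_at)
  ultimately show ?thesis using that deriv by blast
qed

section \<open>Density of the iterated preimages\<close>

text \<open>By the chain rule and the invariance of the density,
  \<open>\<Theta> (tangent_map m) + 2 * \<Theta> m\<close> has derivative 0 away from finitely many
  points; being continuous, it is constant on an interval that misses the pole.\<close>

lemma affine_on_branch:
  fixes \<Theta> :: "real \<Rightarrow> real"
  assumes cont: "continuous_on UNIV \<Theta>"
    and deriv: "\<And>x. x \<noteq> 0 \<Longrightarrow> x \<noteq> -1 \<Longrightarrow> (\<Theta> has_real_derivative invariant_density x) (at x)"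
    and I: "is_interval I" "open I" "-1/2 \<notin> I" "x \<in> I" "y \<in> I"
  shows "\<Theta> (tangent_map x) - \<Theta> (tangent_map y) = - 2 * (\<Theta> x - \<Theta> y)"
proof -
  define h where "h m = \<Theta> (tangent_map m) + 2 * \<Theta> m" for m
  have ne: "2 * m + 1 \<noteq> 0" if "m \<in> I" for m
  proof
    assume "2 * m + 1 = 0"
    then have "m = -1/2" by simp
    then show False using that I by simp
  qed
  have contI: "continuous_on I tangent_map"
    using ne isCont_tangent_map by (meson continuous_at_imp_continuous_on)
  have "h y = h x"
  proof (rule has_derivative_zero_unique_strong_connected[of I "{0, -1, -2, 1}" h x "h x" y])
    show "connected I" using I by (simp add: is_interval_connected)
    show "open I" by fact
    show "continuous_on I h"
      unfolding h_def
      by (intro continuous_intros continuous_on_compose2[OF cont contI]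
          continuous_on_subset[OF cont]) auto
    show "(h has_derivative (\<lambda>_. 0)) (at m within I)" if m: "m \<in> I - {0, -1, -2, 1}" for m
    proof -
      have 2: "2 * m + 1 \<noteq> 0" using m ne by blast
      have "tangent_map m \<noteq> 0" using m 2 by (auto simp: tangent_map_def)
      moreover have "1 + tangent_map m \<noteq> 0"
        unfolding one_plus_tangent_map[OF 2] using m 2 by auto
      then have "tangent_map m \<noteq> -1" by auto
      ultimately have "((\<lambda>m. \<Theta> (tangent_map m)) has_real_derivative invariant_density (tangent_map m)
          * (- 2 * ((m + 2) * (1 - m) / (2 * m + 1)\<^sup>2)\<^sup>2)) (at m)"
        by (intro DERIV_chain2[OF deriv tangent_map_has_real_derivative[OF 2]])
      moreover have "invariant_density (tangent_map m) * (- 2 * ((m + 2) * (1 - m) / (2 * m + 1)\<^sup>2)\<^sup>2)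
          = - 2 * invariant_density m"
        using invariant_density_tangent_map[OF 2] m by simp
      ultimately have "((\<lambda>m. \<Theta> (tangent_map m)) has_real_derivative - 2 * invariant_density m) (at m)"
        by (simp only:)
      then have "(h has_real_derivative - 2 * invariant_density m + 2 * invariant_density m) (at m)"
        unfolding h_def using m by (intro DERIV_add DERIV_cmult deriv) auto
      then have "(h has_real_derivative 0) (at m)"
        by simp
      then have "(h has_derivative (\<lambda>_. 0)) (at m)"
        by (simp add: has_field_derivative_def lambda_zero)
      then show ?thesis by (rule has_derivative_at_withinI)
    qed
  qed (use I in auto)
  then show ?thesis by (simp add: h_def)
qed

text \<open>At its pole the tangent map has the junk value 0, so orbits through the pole are excluded.\<close>

definition avoids :: "nat \<Rightarrow> real \<Rightarrow> bool" where
  "avoids n m \<longleftrightarrow> (\<forall>i<n. (tangent_map ^^ i) m \<noteq> -1/2)"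

lemma avoids_Suc: "avoids (Suc n) m \<longleftrightarrow> m \<noteq> -1/2 \<and> avoids n (tangent_map m)"
  unfolding avoids_def by (simp add: All_less_Suc2 funpow_swap1)

text \<open>Pulling back along the branch that contains the target halves distances measured by
  \<open>\<Theta>\<close>. After \<open>n\<close> steps the total length \<open>T\<close> has shrunk
  to \<open>T / 2 ^ n\<close>; the slack \<open>e\<close> pays for moving targets off the
  pole.\<close>

lemma preimages_close:
  fixes \<Theta> :: "real \<Rightarrow> real"
  assumes bound: "\<And>x y. \<bar>\<Theta> x - \<Theta> y\<bar> \<le> T"
    and cont: "continuous_on UNIV \<Theta>"
    and deriv: "\<And>x. x \<noteq> 0 \<Longrightarrow> x \<noteq> -1 \<Longrightarrow> (\<Theta> has_real_derivative invariant_density x) (at x)"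
    and "e > 0"
  shows "\<exists>k. avoids n k \<and> (tangent_map ^^ n) k = q \<and> \<bar>\<Theta> k - \<Theta> m\<bar> < T / 2 ^ n + e"
  using \<open>e > 0\<close>
proof (induction n arbitrary: m e)
  case 0
  then show ?case using bound[of q m] by (auto simp: avoids_def)
next
  case (Suc n)
  \<comment> \<open>A target at the pole lies on no branch, so it is moved at a cost of
    \<open>e / 2\<close>; the error \<open>e\<close> of the induction hypothesis is halved as well,
    and the two add up to \<open>e\<close>.\<close>
  obtain m' where m': "m' \<noteq> -1/2" "\<bar>\<Theta> m' - \<Theta> m\<bar> < e / 2"
  proof (cases "m = -1/2")
    case True
    have "isCont \<Theta> m" using cont by (simp add: continuous_on_eq_continuous_at)
    then obtain d where d: "d > 0" "\<And>x. dist x m < d \<Longrightarrow> dist (\<Theta> x) (\<Theta> m) < e / 2"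
      using Suc.prems unfolding continuous_at_eps_delta dist_real_def by (metis half_gt_zero)
    show ?thesis
      using d True by (intro that[of "m + d / 2"]) (auto simp: dist_real_def)
  next
    case False
    then show ?thesis using Suc.prems by (intro that[of m]) auto
  qed
  obtain k1 where k1: "avoids n k1" "(tangent_map ^^ n) k1 = q"
    "\<bar>\<Theta> k1 - \<Theta> (tangent_map m')\<bar> < T / 2 ^ n + e"
    using Suc.IH[OF Suc.prems] by blast
  \<comment> \<open>The preimage is taken on the side of the pole where \<open>m'\<close> lies, so
    that the affine relation applies to both.\<close>
  obtain k where k: "tangent_map k = k1" "k \<noteq> -1/2"
    "\<Theta> (tangent_map k) - \<Theta> (tangent_map m') = - 2 * (\<Theta> k - \<Theta> m')"
  proof (cases "m' > -1/2")
    case True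
    obtain k where "k > -1/2" "tangent_map k = k1" using tangent_map_onto_right by blast
    then show ?thesis
      using True affine_on_branch[OF cont deriv, of "{-1/2<..}" k m']
      by (intro that[of k]) auto
  next
    case False
    obtain k where "k < -1/2" "tangent_map k = k1" using tangent_map_onto_left by blast
    then show ?thesis
      using False m' affine_on_branch[OF cont deriv, of "{..<-1/2}" k m']
      by (intro that[of k]) auto
  qed
  have "2 * \<bar>\<Theta> k - \<Theta> m'\<bar> < T / 2 ^ n + e"
    using k1(3) unfolding k(1)[symmetric] k(3) by (simp only: abs_mult abs_neg_numeral)
  then have "\<bar>\<Theta> k - \<Theta> m'\<bar> < T / 2 ^ Suc n + e / 2" by (simp add: field_simps)
  then have "\<bar>\<Theta> k - \<Theta> m\<bar> < T / 2 ^ Suc n + e" using m'(2) by linarith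
  then show ?case
    using k k1 by (intro exI[of _ k]) (simp add: avoids_Suc funpow_swap1)
qed

lemma preimages_dense:
  assumes "l < r"
  shows "\<exists>n k. l < k \<and> k < r \<and> avoids n k \<and> (tangent_map ^^ n) k = q"
proof -
  obtain \<Theta> :: "real \<Rightarrow> real" and T where \<Theta>: "\<And>x y. \<bar>\<Theta> x - \<Theta> y\<bar> \<le> T" "strict_mono \<Theta>"
    "continuous_on UNIV \<Theta>"
    "\<And>x. x \<noteq> 0 \<Longrightarrow> x \<noteq> -1 \<Longrightarrow> (\<Theta> has_real_derivative invariant_density x) (at x)"
    using invariant_density_antiderivative by blast
  define m where "m = (l + r) / 2"
  \<comment> \<open>Closeness under \<open>\<Theta>\<close> within \<open>e\<close> forces a point
    into the interval, since \<open>\<Theta>\<close> is strictly increasing.\<close>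
  define e where "e = min (\<Theta> m - \<Theta> l) (\<Theta> r - \<Theta> m)"
  have "l < m" "m < r" using assms by (auto simp: m_def)
  then have e: "e > 0" using \<Theta>(2) by (simp add: e_def strict_mono_less)
  have "(\<lambda>n. T / 2 ^ n) \<longlonglongrightarrow> 0"
    using LIMSEQ_divide_realpow_zero[of 2 T] by simp
  then have "\<forall>\<^sub>F n in sequentially. T / 2 ^ n < e / 2"
    using e by (intro order_tendstoD(2)) auto
  then obtain n where n: "T / 2 ^ n < e / 2"
    by (auto simp: eventually_sequentially)
  obtain k where k: "avoids n k" "(tangent_map ^^ n) k = q" "\<bar>\<Theta> k - \<Theta> m\<bar> < T / 2 ^ n + e / 2"
    using preimages_close[OF \<Theta>(1,3,4), of "e / 2"] e by (metis half_gt_zero)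
  have "\<bar>\<Theta> k - \<Theta> m\<bar> < e" using k(3) n by linarith
  then have "\<Theta> l < \<Theta> k" "\<Theta> k < \<Theta> r" unfolding e_def by linarith+
  then have "l < k" "k < r" using \<Theta>(2) by (simp_all add: strict_mono_less)
  then show ?thesis using k by blast
qed

lemma eventually_tangent_map_iterates:
  assumes "avoids n k" "e > 0"
  shows "\<forall>\<^sub>F m in nhds k. avoids n m \<and> \<bar>(tangent_map ^^ n) m - (tangent_map ^^ n) k\<bar> < e"
proof -
  have "avoids n k \<Longrightarrow> isCont (tangent_map ^^ n) k \<and> (\<forall>\<^sub>F m in nhds k. avoids n m)" for n
  proof (induction n)
    case 0
    then show ?case by (simp add: avoids_def id_def)
  next
    case (Suc n)
    \<comment> \<open>In contrast to \<open>avoids_Suc\<close> the last point of the orbit is split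
      off, since continuity of the tangent map is needed there.\<close>
    have av: "avoids (Suc n) m \<longleftrightarrow> avoids n m \<and> (tangent_map ^^ n) m \<noteq> -1/2" for m
      by (auto simp: avoids_def less_Suc_eq)
    then have IH: "isCont (tangent_map ^^ n) k" "\<forall>\<^sub>F m in nhds k. avoids n m"
      and ne: "(tangent_map ^^ n) k \<noteq> -1/2"
      using Suc by auto
    have "isCont (\<lambda>m. tangent_map ((tangent_map ^^ n) m)) k"
      by (rule isCont_o2[OF IH(1) isCont_tangent_map]) (use ne in auto)
    moreover have "\<forall>\<^sub>F m in nhds k. (tangent_map ^^ n) m \<noteq> -1/2"
      using IH(1) ne unfolding isCont_def tendsto_at_iff_tendsto_nhds
      by (rule tendsto_imp_eventually_ne)
    ultimately show ?case
      using IH(2) by (simp add: av comp_def eventually_conj)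
  qed
  then have c: "isCont (tangent_map ^^ n) k" "\<forall>\<^sub>F m in nhds k. avoids n m"
    using assms by auto
  have "\<forall>\<^sub>F m in nhds k. dist ((tangent_map ^^ n) m) ((tangent_map ^^ n) k) < e"
    using c(1) assms(2) unfolding isCont_def tendsto_at_iff_tendsto_nhds by (rule tendstoD)
  then show ?thesis
    using c(2) by eventually_elim (simp add: dist_real_def)
qed

section \<open>Density of the rational points\<close>

text \<open>The witnesses are \<open>\<eta> = - t y / w\<close> and \<open>\<zeta> = - z / w\<close>
  for a rational point with coordinate \<open>m\<close> on the cubic with \<open>N = c t^6\<close>.
  The tangent map multiplies \<open>m\<close> and \<open>1 + m\<close> by cubes of rational
  functions of \<open>m\<close>, so new witnesses arise by multiplication.\<close>

lemma tangent_map_cubes: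
  assumes m: "m \<noteq> -1/2" and "m \<in> \<rat>"
    and "\<exists>\<eta>\<in>\<rat>. \<exists>\<zeta>\<in>\<rat>. (1 + N) * m = 2 * \<eta> ^ 3 \<and> (1 - N) * \<zeta> ^ 3 = (1 + m) * (1 + N)"
  shows "tangent_map m \<in> \<rat> \<and> (\<exists>\<eta>\<in>\<rat>. \<exists>\<zeta>\<in>\<rat>. (1 + N) * tangent_map m = 2 * \<eta> ^ 3 \<and>
           (1 - N) * \<zeta> ^ 3 = (1 + tangent_map m) * (1 + N))"
proof -
  obtain \<eta> \<zeta> where r: "\<eta> \<in> \<rat>" "\<zeta> \<in> \<rat>"
    and e: "(1 + N) * m = 2 * \<eta> ^ 3" "(1 - N) * \<zeta> ^ 3 = (1 + m) * (1 + N)"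
    using assms by blast
  have 2: "2 * m + 1 \<noteq> 0" using m by auto
  have "(1 + N) * tangent_map m = - ((1 + N) * m) * ((m + 2) / (2 * m + 1)) ^ 3"
    by (simp add: tangent_map_def power_divide)
  also have "\<dots> = 2 * (- \<eta> * ((m + 2) / (2 * m + 1))) ^ 3"
    unfolding e by algebra
  finally have 1: "(1 + N) * tangent_map m = 2 * (- \<eta> * ((m + 2) / (2 * m + 1))) ^ 3" .
  have "(1 - N) * (\<zeta> * ((1 - m) / (2 * m + 1))) ^ 3
      = ((1 - N) * \<zeta> ^ 3) * ((1 - m) / (2 * m + 1)) ^ 3"
    by algebra
  also have "\<dots> = (1 + tangent_map m) * (1 + N)"
    unfolding e one_plus_tangent_map[OF 2] by (simp add: power_divide)
  finally have "(1 - N) * (\<zeta> * ((1 - m) / (2 * m + 1))) ^ 3 = (1 + tangent_map m) * (1 + N)" .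
  moreover have "tangent_map m \<in> \<rat>" "- \<eta> * ((m + 2) / (2 * m + 1)) \<in> \<rat>"
    "\<zeta> * ((1 - m) / (2 * m + 1)) \<in> \<rat>"
    using assms(2) r unfolding tangent_map_def
    by (auto intro!: Rats_divide Rats_mult Rats_add Rats_diff Rats_power simp: Rats_minus_iff)
  ultimately show ?thesis using 1 by blast
qed

lemma tangent_map_orbit_cubes:
  assumes N: "N \<in> \<rat>" "1 + N \<noteq> 0" and "avoids n (- 2 / (1 + N))"
  shows "(tangent_map ^^ n) (- 2 / (1 + N)) \<in> \<rat> \<and>
    (\<exists>\<eta>\<in>\<rat>. \<exists>\<zeta>\<in>\<rat>. (1 + N) * (tangent_map ^^ n) (- 2 / (1 + N)) = 2 * \<eta> ^ 3 \<and>
      (1 - N) * \<zeta> ^ 3 = (1 + (tangent_map ^^ n) (- 2 / (1 + N))) * (1 + N))"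
  using assms(3)
proof (induction n)
  case 0
  \<comment> \<open>The base point (1, 1, 1) has both witnesses equal to -1.\<close>
  have "(1 + N) * (- 2 / (1 + N)) = 2 * (-1) ^ 3"
    "(1 - N) * (-1) ^ 3 = (1 + - 2 / (1 + N)) * (1 + N)"
    using N by (simp_all add: field_simps)
  moreover have "- 2 / (1 + N) \<in> \<rat>"
    using N by (intro Rats_divide Rats_add) auto
  ultimately show ?case
    unfolding funpow_0 by (metis Rats_1 Rats_minus_iff)
next
  case (Suc n)
  then have "avoids n (- 2 / (1 + N))" "(tangent_map ^^ n) (- 2 / (1 + N)) \<noteq> -1/2"
    by (auto simp: avoids_def less_Suc_eq)
  then show ?case
    using tangent_map_cubes[of "(tangent_map ^^ n) (- 2 / (1 + N))" N] Suc.IH by simp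
qed

text \<open>This undoes the passage to \<open>m\<close>: \<open>y\<close> and \<open>z\<close> are
  read off from the witnesses, \<open>x\<close> from the first fibre equation, and the second fibre
  equation is then the cubic. The coordinate \<open>w\<close> remains a free scale.\<close>

lemma fibre_solution:
  fixes a b c t m w \<eta> \<zeta> :: real
  defines "y \<equiv> - \<eta> * w / t" and "z \<equiv> - \<zeta> * w"
  defines "x \<equiv> y ^ 3 + c * t ^ 3 * (z ^ 3 - w ^ 3)"
  assumes t: "t \<noteq> 0" and c: "b = a * c"
    and \<eta>: "(1 + c * t ^ 6) * m = 2 * \<eta> ^ 3"
    and \<zeta>: "(1 - c * t ^ 6) * \<zeta> ^ 3 = (1 + m) * (1 + c * t ^ 6)"
  shows "a * (x\<^sup>2 - y ^ 6) = b * (z ^ 6 - w ^ 6)"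
proof -
  have ty: "t * y = - \<eta> * w" using t by (simp add: y_def)
  have "t ^ 3 * (x + y ^ 3) = 2 * (t * y) ^ 3 + c * t ^ 6 * (z ^ 3 - w ^ 3)"
    unfolding x_def by algebra
  also have "\<dots> = - (2 * \<eta> ^ 3) * w ^ 3 + c * t ^ 6 * (z ^ 3 - w ^ 3)"
    unfolding ty by algebra
  also have "\<dots> = (1 - c * t ^ 6) * \<zeta> ^ 3 * w ^ 3 - (2 * \<eta> ^ 3) * w ^ 3 - c * t ^ 6 * w ^ 3 + z ^ 3"
    unfolding z_def by algebra
  also have "\<dots> = z ^ 3 + w ^ 3"
    unfolding \<zeta> \<eta>[symmetric] by algebra
  finally have s: "t ^ 3 * (x + y ^ 3) = z ^ 3 + w ^ 3" .
  have "a * (x\<^sup>2 - y ^ 6) = a * ((x - y ^ 3) * (x + y ^ 3))"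
    by algebra
  also have "x - y ^ 3 = c * t ^ 3 * (z ^ 3 - w ^ 3)"
    by (simp add: x_def)
  also have "a * (c * t ^ 3 * (z ^ 3 - w ^ 3) * (x + y ^ 3))
      = a * c * (z ^ 3 - w ^ 3) * (t ^ 3 * (x + y ^ 3))"
    by algebra
  also have "\<dots> = a * c * (z ^ 6 - w ^ 6)"
    unfolding s by algebra
  finally show ?thesis by (simp add: c)
qed

text \<open>Near the base parameter of \<open>t\<^sub>0\<close> some \<open>k\<close> is mapped
  exactly to \<open>q\<close>. It is the base parameter of a real \<open>t\<^sub>1\<close> near
  \<open>t\<^sub>0\<close>, and by continuity of the iterate a rational \<open>t\<close> close to
  \<open>t\<^sub>1\<close> still lands near \<open>q\<close>.\<close>

lemma rational_fibre_approx:
  fixes c t\<^sub>0 q \<delta> :: real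
  assumes c: "c \<noteq> 0" and t0: "t\<^sub>0 \<noteq> 0" and N: "1 + c * t\<^sub>0 ^ 6 \<noteq> 0" and "\<delta> > 0"
  shows "\<exists>t\<in>\<rat>. \<exists>n. \<bar>t - t\<^sub>0\<bar> < \<delta> \<and> avoids n (- 2 / (1 + c * t ^ 6)) \<and>
           \<bar>(tangent_map ^^ n) (- 2 / (1 + c * t ^ 6)) - q\<bar> < \<delta>"
proof -
  \<comment> \<open>This is the local inverse of the base parameter as a function of
    \<open>t\<close>; the sign selects the sixth root near \<open>t\<^sub>0\<close>.\<close>
  define \<tau> where "\<tau> k = sgn t\<^sub>0 * root 6 ((- 2 / k - 1) / c)" for k
  define k\<^sub>0 where "k\<^sub>0 = - 2 / (1 + c * t\<^sub>0 ^ 6)"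
  have k0: "k\<^sub>0 \<noteq> 0" using N by (simp add: k\<^sub>0_def)
  have rad0: "(- 2 / k\<^sub>0 - 1) / c = t\<^sub>0 ^ 6" using c N by (simp add: k\<^sub>0_def field_simps)
  have "t\<^sub>0 ^ 6 = \<bar>t\<^sub>0\<bar> ^ 6" by simp
  then have "root 6 (t\<^sub>0 ^ 6) = \<bar>t\<^sub>0\<bar>" by (metis abs_ge_zero real_root_power_cancel zero_less_numeral)
  then have \<tau>0: "\<tau> k\<^sub>0 = t\<^sub>0" unfolding \<tau>_def rad0 by (simp add: sgn_mult_abs)
  have "(\<tau> \<longlongrightarrow> \<tau> k\<^sub>0) (nhds k\<^sub>0)"
    unfolding \<tau>_def using k0 c by (intro tendsto_intros filterlim_ident) auto
  then have "\<forall>\<^sub>F k in nhds k\<^sub>0. dist (\<tau> k) t\<^sub>0 < \<delta>"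
    using \<open>\<delta> > 0\<close> unfolding \<tau>0 by (rule tendstoD)
  moreover have "((\<lambda>k. (- 2 / k - 1) / c) \<longlongrightarrow> t\<^sub>0 ^ 6) (nhds k\<^sub>0)"
    unfolding rad0[symmetric] using k0 c by (intro tendsto_intros filterlim_ident) auto
  then have "\<forall>\<^sub>F k in nhds k\<^sub>0. (- 2 / k - 1) / c > 0"
    by (rule order_tendstoD) (use t0 in \<open>simp add: zero_less_power_eq\<close>)
  moreover have "\<forall>\<^sub>F k in nhds k\<^sub>0. k \<noteq> 0"
    using filterlim_ident k0 by (rule tendsto_imp_eventually_ne)
  ultimately have "\<forall>\<^sub>F k in nhds k\<^sub>0. dist (\<tau> k) t\<^sub>0 < \<delta> \<and> (- 2 / k - 1) / c > 0 \<and> k \<noteq> 0"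
    by (intro eventually_conj)
  then obtain d where d: "d > 0"
    "\<And>k. dist k k\<^sub>0 < d \<Longrightarrow> dist (\<tau> k) t\<^sub>0 < \<delta> \<and> (- 2 / k - 1) / c > 0 \<and> k \<noteq> 0"
    unfolding eventually_nhds_metric by blast
  obtain n k where k: "k\<^sub>0 - d < k" "k < k\<^sub>0 + d" "avoids n k" "(tangent_map ^^ n) k = q"
    using preimages_dense[of "k\<^sub>0 - d" "k\<^sub>0 + d" q] d(1) by auto
  have "dist k k\<^sub>0 < d" using k by (auto simp: dist_real_def)
  from d(2)[OF this] have \<tau>k: "\<bar>\<tau> k - t\<^sub>0\<bar> < \<delta>" and rad: "(- 2 / k - 1) / c > 0" and "k \<noteq> 0"
    by (auto simp: dist_real_def)
  define t\<^sub>1 where "t\<^sub>1 = \<tau> k"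
  have "t\<^sub>1 ^ 6 = (- 2 / k - 1) / c"
    using rad t0 by (simp add: t\<^sub>1_def \<tau>_def power_mult_distrib sgn_if real_root_pow_pos2)
  then have N1: "1 + c * t\<^sub>1 ^ 6 = - 2 / k" using c by simp
  then have m1: "- 2 / (1 + c * t\<^sub>1 ^ 6) = k" using \<open>k \<noteq> 0\<close> by simp
  have "((\<lambda>t. - 2 / (1 + c * t ^ 6)) \<longlongrightarrow> - 2 / (1 + c * t\<^sub>1 ^ 6)) (nhds t\<^sub>1)"
    using N1 \<open>k \<noteq> 0\<close> by (intro tendsto_intros filterlim_ident) auto
  then have "((\<lambda>t. - 2 / (1 + c * t ^ 6)) \<longlongrightarrow> k) (nhds t\<^sub>1)"
    unfolding m1 .
  with eventually_tangent_map_iterates[OF k(3) \<open>\<delta> > 0\<close>]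
  have "\<forall>\<^sub>F t in nhds t\<^sub>1. avoids n (- 2 / (1 + c * t ^ 6)) \<and>
      \<bar>(tangent_map ^^ n) (- 2 / (1 + c * t ^ 6)) - (tangent_map ^^ n) k\<bar> < \<delta>"
    by (rule eventually_compose_filterlim)
  moreover have "\<forall>\<^sub>F t in nhds t\<^sub>1. dist t t\<^sub>1 < \<delta> - \<bar>t\<^sub>1 - t\<^sub>0\<bar>"
    using \<tau>k by (intro tendstoD[OF filterlim_ident]) (simp add: t\<^sub>1_def)
  ultimately have "\<forall>\<^sub>F t in nhds t\<^sub>1. \<bar>t - t\<^sub>0\<bar> < \<delta> \<and> avoids n (- 2 / (1 + c * t ^ 6)) \<and>
      \<bar>(tangent_map ^^ n) (- 2 / (1 + c * t ^ 6)) - q\<bar> < \<delta>"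
    unfolding k(4) by eventually_elim (auto simp: dist_real_def)
  then obtain d' where d': "d' > 0" "\<And>t. dist t t\<^sub>1 < d' \<Longrightarrow> \<bar>t - t\<^sub>0\<bar> < \<delta> \<and>
      avoids n (- 2 / (1 + c * t ^ 6)) \<and> \<bar>(tangent_map ^^ n) (- 2 / (1 + c * t ^ 6)) - q\<bar> < \<delta>"
    unfolding eventually_nhds_metric by blast
  obtain t where t: "t \<in> \<rat>" "t\<^sub>1 < t" "t < t\<^sub>1 + d'"
    using Rats_dense_in_real[of t\<^sub>1 "t\<^sub>1 + d'"] d'(1) by auto
  then have "dist t t\<^sub>1 < d'" by (simp add: dist_real_def)
  from d'(2)[OF this] t(1) show ?thesis by blast
qed

text \<open>Density is proved in this affine form, to which \<open>dense_iff_dense_cone\<close>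
  reduces the projective one.\<close>

definition rational_cone :: "int \<Rightarrow> int \<Rightarrow> real4 set" where
  "rational_cone a b = real4_of_rat ` {r. solves_eqn a b r}"

lemma rational_coneI:
  assumes "solves_eqn a b (x, y, z, w)" "x \<in> \<rat>" "y \<in> \<rat>" "z \<in> \<rat>" "w \<in> \<rat>"
  shows "(x, y, z, w) \<in> rational_cone a b"
proof -
  obtain x' y' z' w' where "x = of_rat x'" "y = of_rat y'" "z = of_rat z'" "w = of_rat w'"
    using assms(2-5) by (auto elim!: Rats_cases)
  then have "(x, y, z, w) = real4_of_rat (x', y', z', w')"
    by (simp add: real4_of_rat_def)
  then show ?thesis
    using assms(1) by (auto simp: rational_cone_def solves_eqn_real4_of_rat)
qed

text \<open>The point is a continuous function of its fibre \<open>t\<close>, its coordinate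
  \<open>q\<close> on the cubic and its scale \<open>w\<close>. All three are approximated:
  \<open>t\<close> and \<open>w\<close> by rationals, \<open>q\<close> by iterates of the base point
  on the nearby rational fibres, which come from rational points.\<close>

lemma generic_point_in_closure:
  fixes a b :: int and t x y z w :: real
  defines "c \<equiv> of_int b / of_int a"
  assumes a: "a \<noteq> 0" and b: "b \<noteq> 0" and t: "t \<noteq> 0" and w: "w \<noteq> 0"
    and N: "1 + c * t ^ 6 \<noteq> 0" "1 - c * t ^ 6 \<noteq> 0"
    and diff: "x - y ^ 3 = c * t ^ 3 * (z ^ 3 - w ^ 3)"
    and sum: "t ^ 3 * (x + y ^ 3) = z ^ 3 + w ^ 3"
  shows "(x, y, z, w) \<in> closure (rational_cone a b)"
proof -
  have c: "c \<noteq> 0" "c \<in> \<rat>" "of_int b = of_int a * c" using a b by (auto simp: c_def)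
  define q where "q = - 2 * (t * y) ^ 3 / ((1 + c * t ^ 6) * w ^ 3)"
  define Y where "Y t m w = - root 3 ((1 + c * t ^ 6) * m / 2) * w / t" for t m w
  define Z where "Z t m w = - root 3 ((1 + m) * (1 + c * t ^ 6) / (1 - c * t ^ 6)) * w" for t m w
  define X where "X t m w = Y t m w ^ 3 + c * t ^ 3 * (Z t m w ^ 3 - w ^ 3)" for t m w
  have root3: "root 3 (r ^ 3) = r" for r
    by (simp add: odd_real_root_power_cancel)
  have "(1 + c * t ^ 6) * q / 2 = (- (t * y / w)) ^ 3"
    using N(1) w by (simp add: q_def power_divide)
  then have Yq: "Y t q w = y" using t w root3[of "- (t * y / w)"] by (simp add: Y_def)
  have "2 * (t * y) ^ 3 = t ^ 3 * (x + y ^ 3) - t ^ 3 * (x - y ^ 3)" by algebra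
  also have "\<dots> = (1 - c * t ^ 6) * z ^ 3 + (1 + c * t ^ 6) * w ^ 3" unfolding sum diff by algebra
  finally have cubic: "2 * (t * y) ^ 3 = (1 - c * t ^ 6) * z ^ 3 + (1 + c * t ^ 6) * w ^ 3" .
  have "q * (1 + c * t ^ 6) = - 2 * (t * y) ^ 3 / w ^ 3"
    using N(1) by (simp add: q_def)
  then have "(1 + q) * (1 + c * t ^ 6) = ((1 + c * t ^ 6) * w ^ 3 - 2 * (t * y) ^ 3) / w ^ 3"
    using w by (simp add: distrib_right[of 1 q] diff_divide_distrib)
  also have "\<dots> = (1 - c * t ^ 6) * (- (z / w)) ^ 3"
    unfolding cubic by (simp add: power_divide)
  finally have "(1 + q) * (1 + c * t ^ 6) / (1 - c * t ^ 6) = (- (z / w)) ^ 3"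
    using N(2) by simp
  then have Zq: "Z t q w = z" using w root3[of "- (z / w)"] by (simp add: Z_def)
  have Xq: "X t q w = x" using diff by (simp add: X_def Yq Zq)
  have "\<exists>t' n. t' \<in> \<rat> \<and> \<bar>t' - t\<bar> < 1 / real (Suc i) \<and> avoids n (- 2 / (1 + c * t' ^ 6)) \<and>
      \<bar>(tangent_map ^^ n) (- 2 / (1 + c * t' ^ 6)) - q\<bar> < 1 / real (Suc i)" for i
    using rational_fibre_approx[OF c(1) t N(1), of "1 / real (Suc i)" q] by auto
  then obtain T n where T: "\<And>i. T i \<in> \<rat>" "\<And>i. \<bar>T i - t\<bar> < 1 / real (Suc i)"
    "\<And>i. avoids (n i) (- 2 / (1 + c * T i ^ 6))"
    "\<And>i. \<bar>(tangent_map ^^ n i) (- 2 / (1 + c * T i ^ 6)) - q\<bar> < 1 / real (Suc i)"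
    by metis
  define M where "M i = (tangent_map ^^ n i) (- 2 / (1 + c * T i ^ 6))" for i
  have "\<exists>w'\<in>\<rat>. w < w' \<and> w' < w + 1 / real (Suc i)" for i
    by (rule Rats_dense_in_real) simp
  then obtain W where W: "\<And>i. W i \<in> \<rat>" "\<And>i. w < W i" "\<And>i. W i < w + 1 / real (Suc i)"
    by metis
  have lim: "f \<longlonglongrightarrow> l" if "\<And>i. \<bar>f i - l\<bar> < 1 / real (Suc i)" for f and l :: real
  proof (rule LIM_zero_cancel, rule tendsto_0_le[of "\<lambda>i. 1 / real (Suc i)" _ _ 1])
    show "(\<lambda>i. 1 / real (Suc i)) \<longlonglongrightarrow> 0"
      by (rule LIMSEQ_inverse_real_of_nat[unfolded inverse_eq_divide])
    show "\<forall>\<^sub>F i in sequentially. norm (f i - l) \<le> norm (1 / real (Suc i)) * 1"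
      using that by (intro always_eventually allI) (simp add: less_imp_le)
  qed
  have limT: "T \<longlonglongrightarrow> t" using lim[of T t] T(2) by simp
  have limM: "M \<longlonglongrightarrow> q" using lim[of M q] T(4) by (simp add: M_def)
  have limW: "W \<longlonglongrightarrow> w"
  proof (rule lim)
    show "\<bar>W i - w\<bar> < 1 / real (Suc i)" for i using W(2,3)[of i] by linarith
  qed
  have limY: "(\<lambda>i. Y (T i) (M i) (W i)) \<longlonglongrightarrow> y"
    unfolding Yq[symmetric] unfolding Y_def using t by (intro tendsto_intros limT limM limW) auto
  have limZ: "(\<lambda>i. Z (T i) (M i) (W i)) \<longlonglongrightarrow> z"
    unfolding Zq[symmetric] unfolding Z_def using N by (intro tendsto_intros limT limM limW) auto
  have limX: "(\<lambda>i. X (T i) (M i) (W i)) \<longlonglongrightarrow> x"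
    unfolding Xq[symmetric] unfolding X_def Yq Zq by (intro tendsto_intros limY limZ limT limW)
  have "(\<lambda>i. (X (T i) (M i) (W i), Y (T i) (M i) (W i), Z (T i) (M i) (W i), W i)) \<longlonglongrightarrow> (x, y, z, w)"
    by (intro tendsto_Pair limX limY limZ limW)
  moreover have "\<forall>\<^sub>F i in sequentially. (X (T i) (M i) (W i), Y (T i) (M i) (W i), Z (T i) (M i) (W i), W i)
      \<in> rational_cone a b"
  proof -
    have "\<forall>\<^sub>F i in sequentially. T i \<noteq> 0"
      using limT t by (rule tendsto_imp_eventually_ne)
    moreover have "\<forall>\<^sub>F i in sequentially. 1 + c * T i ^ 6 \<noteq> 0"
      by (rule tendsto_imp_eventually_ne[OF _ N(1)]) (intro tendsto_intros limT)
    moreover have "\<forall>\<^sub>F i in sequentially. 1 - c * T i ^ 6 \<noteq> 0"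
      by (rule tendsto_imp_eventually_ne[OF _ N(2)]) (intro tendsto_intros limT)
    ultimately show ?thesis
    proof eventually_elim
      case (elim i)
      have "c * T i ^ 6 \<in> \<rat>" using c T(1) by (intro Rats_mult Rats_power)
      from tangent_map_orbit_cubes[OF this elim(2) T(3)]
      obtain \<eta> \<zeta> where r: "\<eta> \<in> \<rat>" "\<zeta> \<in> \<rat>" and e: "(1 + c * T i ^ 6) * M i = 2 * \<eta> ^ 3"
        "(1 - c * T i ^ 6) * \<zeta> ^ 3 = (1 + M i) * (1 + c * T i ^ 6)"
        unfolding M_def by blast
      \<comment> \<open>Real cube roots are unique, so the roots in \<open>Y\<close> and
        \<open>Z\<close> are the rational witnesses.\<close>
      have Y: "Y (T i) (M i) (W i) = - \<eta> * W i / T i"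
        unfolding Y_def e(1) using root3[of \<eta>] by simp
      have Z: "Z (T i) (M i) (W i) = - \<zeta> * W i"
        unfolding Z_def e(2)[symmetric] using root3[of \<zeta>] elim by simp
      have "solves_eqn a b (X (T i) (M i) (W i), Y (T i) (M i) (W i), Z (T i) (M i) (W i), W i)"
        unfolding solves_eqn_def split X_def Y Z
        by (rule fibre_solution[OF elim(1) c(3) e])
      moreover have "Y (T i) (M i) (W i) \<in> \<rat>" "Z (T i) (M i) (W i) \<in> \<rat>"
        unfolding Y Z using r W(1) T(1) by (auto intro!: Rats_divide Rats_mult simp: Rats_minus_iff)
      moreover from this have "X (T i) (M i) (W i) \<in> \<rat>"
        unfolding X_def using c T(1) W(1) by (intro Rats_add Rats_mult Rats_power Rats_diff)
      ultimately show ?case using W(1) by (intro rational_coneI)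
    qed
  qed
  then have "\<forall>\<^sub>F i in sequentially. (X (T i) (M i) (W i), Y (T i) (M i) (W i), Z (T i) (M i) (W i), W i)
      \<in> closure (rational_cone a b)"
    by eventually_elim (rule subsetD[OF closure_subset])
  ultimately show ?thesis
    by (intro Lim_in_closed_set[OF closed_closure _ sequentially_bot])
qed

section \<open>Perturbation of points in special position\<close>

lemma power6_eq_iff: "(x :: real) ^ 6 = y ^ 6 \<longleftrightarrow> x = y \<or> x = - y"
proof -
  have "x ^ 6 = y ^ 6 \<longleftrightarrow> \<bar>x\<bar> ^ 6 = \<bar>y\<bar> ^ 6" by simp
  also have "\<dots> \<longleftrightarrow> \<bar>x\<bar> = \<bar>y\<bar>" by (intro power_eq_iff_eq_base) auto
  finally show ?thesis by (simp add: abs_eq_iff)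
qed

lemma eventually_power6_ne: "\<forall>\<^sub>F h in at 0. (t + h :: real) ^ 6 \<noteq> K"
proof (cases "K \<ge> 0")
  case True
  then have K: "K = root 6 K ^ 6" by simp
  have "\<forall>\<^sub>F h in at 0. h \<noteq> root 6 K - t" "\<forall>\<^sub>F h in at 0. h \<noteq> - root 6 K - t"
    by (rule eventually_neq_at_within)+
  then show ?thesis
  proof eventually_elim
    case (elim h)
    then have "t + h \<noteq> root 6 K" "t + h \<noteq> - root 6 K" by auto
    then show ?case by (subst K) (simp add: power6_eq_iff del: real_root_pow_pos2)
  qed
next
  case False
  have "(t + h) ^ 6 \<ge> 0" for h by simp
  with False have "(t + h) ^ 6 \<noteq> K" for h by (metis)
  then show ?thesis by simp
qed

text \<open>As \<open>z ^ 6 \<noteq> w ^ 6\<close>, the point lies on a fibre with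
  \<open>t \<noteq> 0\<close>. Shifting \<open>t\<close> and \<open>w\<close> by the same small
  \<open>h\<close> makes it generic for all but finitely many \<open>h\<close>, and the closure is
  closed.\<close>

lemma nondegenerate_point_in_closure:
  fixes a b :: int and x y z w :: real
  assumes a: "a \<noteq> 0" and b: "b \<noteq> 0" and sol: "solves_eqn a b (x, y, z, w)" and zw: "z ^ 6 \<noteq> w ^ 6"
  shows "(x, y, z, w) \<in> closure (rational_cone a b)"
proof -
  define c :: real where "c = of_int b / of_int a"
  have c: "c \<noteq> 0" "of_int b = of_int a * c" using a b by (auto simp: c_def)
  have "of_int a * (x\<^sup>2 - y ^ 6) = of_int a * (c * (z ^ 6 - w ^ 6))"
    using sol c(2) by (simp add: solves_eqn_def)
  then have "x\<^sup>2 - y ^ 6 = c * (z ^ 6 - w ^ 6)" using a by simp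
  moreover have "x\<^sup>2 - y ^ 6 = (x - y ^ 3) * (x + y ^ 3)"
    "z ^ 6 - w ^ 6 = (z ^ 3 - w ^ 3) * (z ^ 3 + w ^ 3)" by algebra+
  ultimately have prod: "(x - y ^ 3) * (x + y ^ 3) = c * (z ^ 3 - w ^ 3) * (z ^ 3 + w ^ 3)"
    and ne: "z ^ 3 - w ^ 3 \<noteq> 0" "x - y ^ 3 \<noteq> 0"
    using zw c by auto
  define t where "t = root 3 ((x - y ^ 3) / (c * (z ^ 3 - w ^ 3)))"
  have t3: "t ^ 3 = (x - y ^ 3) / (c * (z ^ 3 - w ^ 3))"
    by (simp add: t_def odd_real_root_pow)
  then have t: "t \<noteq> 0" using ne c by auto
  have diff: "x - y ^ 3 = c * t ^ 3 * (z ^ 3 - w ^ 3)"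
    unfolding t3 using ne c by simp
  have "t ^ 3 * (x + y ^ 3) = (x - y ^ 3) * (x + y ^ 3) / (c * (z ^ 3 - w ^ 3))"
    unfolding t3 by simp
  also have "\<dots> = z ^ 3 + w ^ 3"
    unfolding prod using ne c by simp
  finally have sum: "x + y ^ 3 = (z ^ 3 + w ^ 3) / t ^ 3"
    using t by (simp add: field_simps)
  \<comment> \<open>On the fibre \<open>t + h\<close>, with \<open>z\<close> kept and
    \<open>w\<close> replaced by \<open>w + h\<close>, the equations prescribe \<open>A h\<close>
    for \<open>x - y ^ 3\<close> and \<open>B h\<close> for \<open>x + y ^ 3\<close>;
    \<open>v h\<close> solves them.\<close>
  define A where "A h = c * (t + h) ^ 3 * (z ^ 3 - (w + h) ^ 3)" for h
  define B where "B h = (z ^ 3 + (w + h) ^ 3) / (t + h) ^ 3" for h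
  define v where "v h = ((A h + B h) / 2, root 3 ((B h - A h) / 2), z, w + h)" for h
  have "(v \<longlongrightarrow> v 0) (at 0)"
    unfolding v_def A_def B_def using t by (intro tendsto_intros) auto
  moreover have "A 0 = x - y ^ 3" "B 0 = x + y ^ 3"
    by (simp_all add: A_def B_def diff sum)
  then have "v 0 = (x, y, z, w)"
    by (simp add: v_def odd_real_root_power_cancel)
  ultimately have "(v \<longlongrightarrow> (x, y, z, w)) (at 0)" by simp
  moreover have "\<forall>\<^sub>F h in at 0. v h \<in> closure (rational_cone a b)"
  proof -
    have "\<forall>\<^sub>F h in at 0. h \<noteq> - t" "\<forall>\<^sub>F h in at 0. h \<noteq> - w"
      by (rule eventually_neq_at_within)+
    then show ?thesis
      using eventually_power6_ne[of t "- 1 / c"] eventually_power6_ne[of t "1 / c"]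
    proof eventually_elim
      case (elim h)
      have th: "t + h \<noteq> 0" "w + h \<noteq> 0" using elim by auto
      have N: "1 + c * (t + h) ^ 6 \<noteq> 0" "1 - c * (t + h) ^ 6 \<noteq> 0"
        using elim(3,4) c(1) by (auto simp: field_simps)
      have r: "root 3 ((B h - A h) / 2) ^ 3 = (B h - A h) / 2" by (simp add: odd_real_root_pow)
      show ?case unfolding v_def
      proof (rule generic_point_in_closure[OF a b th, folded c_def, OF N])
        show "(A h + B h) / 2 - root 3 ((B h - A h) / 2) ^ 3
            = c * (t + h) ^ 3 * (z ^ 3 - (w + h) ^ 3)"
          unfolding r by (simp add: A_def field_simps)
        have "(A h + B h) / 2 + (B h - A h) / 2 = B h" by (simp add: field_simps)
        then show "(t + h) ^ 3 * ((A h + B h) / 2 + root 3 ((B h - A h) / 2) ^ 3)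
            = z ^ 3 + (w + h) ^ 3"
          unfolding r using th by (simp add: B_def)
      qed
    qed
  qed
  ultimately show ?thesis
    by (intro Lim_in_closed_set[OF closed_closure]) auto
qed

text \<open>A point with \<open>z ^ 6 = w ^ 6\<close> is a limit of points already treated: for
  \<open>x \<noteq> 0\<close> one moves \<open>z\<close> and solves for \<open>x\<close>; for
  \<open>x = 0\<close> one first moves along a trivial curve to points with nonzero
  \<open>x\<close>.\<close>

lemma real_point_in_closure:
  fixes a b :: int and x y z w :: real
  assumes a: "a \<noteq> 0" and b: "b \<noteq> 0" and sol: "solves_eqn a b (x, y, z, w)"
  shows "(x, y, z, w) \<in> closure (rational_cone a b)"
proof -
  define c :: real where "c = of_int b / of_int a"
  have c: "of_int b = of_int a * c" using a by (simp add: c_def)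
  have nonzero: "(x, y, z, w) \<in> closure (rational_cone a b)"
    if x: "x \<noteq> 0" and zw: "z ^ 6 = w ^ 6" and sol: "solves_eqn a b (x, y, z, w)" for x y z w :: real
  proof -
    have xy: "x\<^sup>2 = y ^ 6" using sol zw a by (simp add: solves_eqn_def)
    \<comment> \<open>This is the value that the equation forces on the square of the first
      coordinate when \<open>z\<close> moves to \<open>z + h\<close>; it stays positive because
      \<open>x \<noteq> 0\<close>.\<close>
    define p where "p h = y ^ 6 + c * ((z + h) ^ 6 - w ^ 6)" for h
    have "(p \<longlongrightarrow> p 0) (at 0)" unfolding p_def by (intro tendsto_intros)
    moreover have "p 0 = x\<^sup>2" by (simp add: p_def zw xy)
    ultimately have p: "(p \<longlongrightarrow> x\<^sup>2) (at 0)" by simp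
    have "((\<lambda>h. (sgn x * sqrt (p h), y, z + h, w)) \<longlongrightarrow> (sgn x * sqrt (x\<^sup>2), y, z + 0, w)) (at 0)"
      by (intro tendsto_intros p)
    then have "((\<lambda>h. (sgn x * sqrt (p h), y, z + h, w)) \<longlongrightarrow> (x, y, z, w)) (at 0)"
      by (simp add: sgn_mult_abs)
    moreover have "\<forall>\<^sub>F h in at 0. (sgn x * sqrt (p h), y, z + h, w) \<in> closure (rational_cone a b)"
    proof -
      have "\<forall>\<^sub>F h in at 0. p h > 0" using p x by (intro order_tendstoD(1)[OF p]) simp
      then show ?thesis using eventually_power6_ne[of z "w ^ 6"]
      proof eventually_elim
        case (elim h)
        have "(sgn x * sqrt (p h))\<^sup>2 = p h"
          using elim x by (simp add: power_mult_distrib sgn_if)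
        then have "solves_eqn a b (sgn x * sqrt (p h), y, z + h, w)"
          by (simp add: solves_eqn_def c p_def)
        then show ?case using elim by (intro nondegenerate_point_in_closure[OF a b])
      qed
    qed
    ultimately show ?thesis by (intro Lim_in_closed_set[OF closed_closure]) auto
  qed
  show ?thesis
  proof (cases "z ^ 6 = w ^ 6")
    case False
    then show ?thesis using nondegenerate_point_in_closure[OF a b sol] by blast
  next
    case zw: True
    show ?thesis
    proof (cases "x = 0")
      case False
      then show ?thesis using nonzero zw sol by blast
    next
      case True
      then have "y = 0" using sol zw a by (simp add: solves_eqn_def)
      \<comment> \<open>These trivial solutions have nonzero first coordinate for
        \<open>h \<noteq> 0\<close>, so the case above applies to them.\<close>
      have "((\<lambda>h::real. (h ^ 3, h, z, w)) \<longlongrightarrow> (0 ^ 3, 0, z, w)) (at 0)"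
        by (intro tendsto_intros)
      then have "((\<lambda>h::real. (h ^ 3, h, z, w)) \<longlongrightarrow> (x, y, z, w)) (at 0)"
        using True \<open>y = 0\<close> by simp
      moreover have "\<forall>\<^sub>F h::real in at 0. h \<noteq> 0" by (rule eventually_neq_at_within)
      then have "\<forall>\<^sub>F h::real in at 0. (h ^ 3, h, z, w) \<in> closure (rational_cone a b)"
        by eventually_elim (rule nonzero, use zw in \<open>simp_all add: solves_eqn_def\<close>)
      ultimately show ?thesis by (intro Lim_in_closed_set[OF closed_closure]) auto
    qed
  qed
qed

lemma dense_rational_points:
  assumes "a \<noteq> 0" "b \<noteq> 0"
  shows "subtopology wproj_topology (real_points a b) closure_of rational_points a b = real_points a b"
  unfolding dense_iff_dense_cone
  using real_point_in_closure[OF assms] by (auto simp: rational_cone_def)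

theorem theorem2p1:
  fixes a b :: int
  assumes "a \<noteq> 0" and "b \<noteq> 0"
  shows "infinite {(x :: int poly, y :: int poly, z :: int poly, w :: int poly).
           solves_eqn a b (x, y, z, w) \<and> \<not> trivial_sol a b (x, y, z, w) \<and>
           gcd x (gcd y (gcd z w)) = 1}
       \<and> subtopology wproj_topology (real_points a b) closure_of rational_points a b
           = real_points a b"
  using infinite_polynomial_solutions[OF assms] dense_rational_points[OF assms] by blast

end
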